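(* Let $c_1,c_2,\delta>0$. Model GR, i.e. the iteration map $$x_1(t+1)=x_1(t)+\delta\,G_1(x_1(t),x_2(t)),\qquad x_2(t+1)=R_2(x_1(t+1)),$$ has a unique equilibrium $(x_1,x_2)$ with $x_1,x_2>0$. This equilibrium is locally stable if $R_{GR}<0$, where $$R_{GR}=64\,c_1^3c_2\delta^4-96\,c_1^2c_2\delta^2-81\,c_1^2+18\,c_1c_2-c_2^2 .$$ Furthermore, the only possible bifurcation for the equilibrium of Model GR (as the parameters $(c_1,c_2,\delta)$ vary in the positive orthant) is the period-doubling bifurcation, which may take place when $R_{GR}=0$; that is, at any parameter point where the equilibrium loses its stability one has $DQ=-1$ (and not $DQ=1$), and $R_{GR}=0$.
   Context: Parameters: $c_1,c_2,\delta>0$. For $x_1,x_2>0$, $$G_1(x_1,x_2)=\frac{x_1x_2}{(x_1+x_2)^2}-2c_1x_1^2 .$$ For $x_1>0$, $R_2(x_1)$ denotes the unique positive solution $x_2$ of the cubic equation $x_1-2c_2x_2(x_2+x_1)^2=0$. Model GR is equivalently described by the one-dimensional map $x_1\mapsto x_1+\delta\,G_1(x_1,R_2(x_1))$, with $x_2=R_2(x_1)$. An equilibrium is a fixed point: $x_1=x_1+\delta G_1(x_1,x_2)$, $x_2=R_2(x_1)$. Let $$DQ=\frac{\mathrm d}{\mathrm dx_1}\bigl[x_1+\delta\,G_1(x_1,R_2(x_1))\bigr]$$ evaluated at the positive equilibrium. The equilibrium is called locally stable if $|DQ|<1$ (the linearized stability criterion). Bifurcation terminology: the equilibrium "loses its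 stability" at a parameter point of the positive orthant $\{c_1,c_2,\delta>0\}$ lying on the boundary of the set of parameters where it is locally stable (and not in that set); a period-doubling (resp. fold) bifurcation is possible there if $DQ=-1$ (resp. $DQ=1$). *)

theory Defs
  imports "HOL-Analysis.Analysis"
begin

definition G1 :: "real \<Rightarrow> real \<Rightarrow> real \<Rightarrow> real" where
  "G1 c1 x1 x2 = x1 * x2 / (x1 + x2)^2 - 2 * c1 * x1^2"

text \<open>Only meaningful for \<open>x1 > 0\<close> (and \<open>c2 > 0\<close>); see the lemma below.\<close>
definition R2 :: "real \<Rightarrow> real \<Rightarrow> real" where
  "R2 c2 x1 = (THE x2. x2 > 0 \<and> x1 - 2 * c2 * x2 * (x2 + x1)^2 = 0)"

lemma R2_ex1:
  fixes c2 x1 :: real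
  assumes "c2 > 0" "x1 > 0"
  shows "\<exists>!x2. x2 > 0 \<and> x1 - 2 * c2 * x2 * (x2 + x1)^2 = 0"
proof -
  define f where "f = (\<lambda>y::real. 2 * c2 * y * (y + x1)^2)"
  have mono: "f y < f z" if "0 \<le> y" "y < z" for y z
  proof -
    have "(y + x1)^2 \<le> (z + x1)^2"
      using that assms by (intro power_mono) auto
    moreover have "2 * c2 * y < 2 * c2 * z" using that assms by simp
    moreover have "0 \<le> 2 * c2 * y" "0 < (y + x1)^2" using that assms by auto
    ultimately show ?thesis
      unfolding f_def by (metis mult_less_le_imp_less)
  qed
  define b where "b = 1 / (2 * c2 * x1)"
  have b: "b > 0" using assms by (simp add: b_def)
  have "x1^2 \<le> (b + x1)^2"
    using b assms by (intro power_mono) auto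
  hence "x1 \<le> f b"
    using assms by (simp add: f_def b_def power2_eq_square pos_le_divide_eq)
  moreover have "f 0 \<le> x1" using assms by (simp add: f_def)
  moreover have "continuous_on {0..b} f"
    unfolding f_def by (intro continuous_intros)
  ultimately obtain y where y: "0 \<le> y" "f y = x1"
    using IVT'[of f 0 x1 b] b by auto
  hence "y \<noteq> 0" using assms by (auto simp: f_def)
  show ?thesis
  proof (rule ex1I[of _ y])
    show "y > 0 \<and> x1 - 2 * c2 * y * (y + x1)^2 = 0"
      using y \<open>y \<noteq> 0\<close> by (auto simp: f_def)
  next
    fix z assume "z > 0 \<and> x1 - 2 * c2 * z * (z + x1)^2 = 0"
    hence "z > 0" "f z = f y" using y by (auto simp: f_def)
    thus "z = y" using mono[of z y] mono[of y z] y by linarith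
  qed
qed

definition GR_step :: "real \<Rightarrow> real \<Rightarrow> real \<Rightarrow> real \<times> real \<Rightarrow> real \<times> real" where
  "GR_step c1 c2 \<delta> = (\<lambda>(x1, x2).
     let y1 = x1 + \<delta> * G1 c1 x1 x2 in (y1, R2 c2 y1))"

definition GR_map :: "real \<Rightarrow> real \<Rightarrow> real \<Rightarrow> real \<Rightarrow> real" where
  "GR_map c1 c2 \<delta> x1 = x1 + \<delta> * G1 c1 x1 (R2 c2 x1)"

definition GR_pos_equilibrium :: "real \<Rightarrow> real \<Rightarrow> real \<Rightarrow> real \<times> real \<Rightarrow> bool" where
  "GR_pos_equilibrium c1 c2 \<delta> p \<longleftrightarrow> fst p > 0 \<and> snd p > 0 \<and> GR_step c1 c2 \<delta> p = p"

definition GR_equilibrium :: "real \<Rightarrow> real \<Rightarrow> real \<Rightarrow> real \<times> real" where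
  "GR_equilibrium c1 c2 \<delta> = (THE p. GR_pos_equilibrium c1 c2 \<delta> p)"

definition DQ :: "real \<Rightarrow> real \<Rightarrow> real \<Rightarrow> real" where
  "DQ c1 c2 \<delta> = deriv (GR_map c1 c2 \<delta>) (fst (GR_equilibrium c1 c2 \<delta>))"

text \<open>Differentiability is required explicitly wherever \<open>DQ\<close> is used,
  since \<^const>\<open>deriv\<close> is unspecified at points of non-differentiability.\<close>
definition GR_differentiable :: "real \<Rightarrow> real \<Rightarrow> real \<Rightarrow> bool" where
  "GR_differentiable c1 c2 \<delta> \<longleftrightarrow>
     GR_map c1 c2 \<delta> differentiable (at (fst (GR_equilibrium c1 c2 \<delta>)))"

definition GR_locally_stable :: "real \<Rightarrow> real \<Rightarrow> real \<Rightarrow> bool" where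
  "GR_locally_stable c1 c2 \<delta> \<longleftrightarrow> GR_differentiable c1 c2 \<delta> \<and> \<bar>DQ c1 c2 \<delta>\<bar> < 1"

definition GR_stable_set :: "(real \<times> real \<times> real) set" where
  "GR_stable_set = {(c1, c2, \<delta>). c1 > 0 \<and> c2 > 0 \<and> \<delta> > 0 \<and> GR_locally_stable c1 c2 \<delta>}"

text \<open>The positive orthant is open, so for points inside it the frontier in the whole
  space agrees with the frontier relative to the orthant.\<close>
definition GR_loses_stability :: "real \<Rightarrow> real \<Rightarrow> real \<Rightarrow> bool" where
  "GR_loses_stability c1 c2 \<delta> \<longleftrightarrow>
     c1 > 0 \<and> c2 > 0 \<and> \<delta> > 0 \<and>
     (c1, c2, \<delta>) \<in> frontier GR_stable_set \<and> (c1, c2, \<delta>) \<notin> GR_stable_set"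

definition GR_period_doubling_possible :: "real \<Rightarrow> real \<Rightarrow> real \<Rightarrow> bool" where
  "GR_period_doubling_possible c1 c2 \<delta> \<longleftrightarrow>
     GR_loses_stability c1 c2 \<delta> \<and> GR_differentiable c1 c2 \<delta> \<and> DQ c1 c2 \<delta> = -1"

definition GR_fold_possible :: "real \<Rightarrow> real \<Rightarrow> real \<Rightarrow> bool" where
  "GR_fold_possible c1 c2 \<delta> \<longleftrightarrow>
     GR_loses_stability c1 c2 \<delta> \<and> GR_differentiable c1 c2 \<delta> \<and> DQ c1 c2 \<delta> = 1"

definition R_GR :: "real \<Rightarrow> real \<Rightarrow> real \<Rightarrow> real" where
  "R_GR c1 c2 \<delta> = 64 * c1^3 * c2 * \<delta>^4 - 96 * c1^2 * c2 * \<delta>^2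
     - 81 * c1^2 + 18 * c1 * c2 - c2^2"

end

theory Submission
  imports Defs
begin

text \<open>In terms of the ratio \<open>t = x2 / x1\<close> the cubic becomes
  \<open>2 c2 t (1 + t)\<^sup>2 x1\<^sup>2 = 1\<close>, so \<open>t \<mapsto> x1\<close> is explicit and the derivative of
  \<open>x1 \<mapsto> R2 c2 x1 / x1\<close> follows from the inverse function theorem. The map becomes
  \<open>x1 + \<delta> (t / (1 + t)\<^sup>2 - 2 c1 x1\<^sup>2)\<close>, whose only equilibrium has \<open>t\<^sup>2 = c1 / c2\<close>.
  There \<open>DQ = 1 - 2 k\<close> with \<open>k > 0\<close> (\<open>half_drop\<close> below), and \<open>R_GR\<close> is a positive multiple of \<open>k\<^sup>2 - 1\<close>.
  Hence the stable set is exactly \<open>R_GR < 0\<close>, and since \<open>R_GR\<close> is continuous, stability can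
  only be lost where \<open>k = 1\<close>, that is \<open>DQ = -1\<close>.\<close>

section \<open>Parametrisation of the cubic by the ratio \<open>t = x2 / x1\<close>\<close>

text \<open>On positive arguments this is the inverse of \<open>x1 \<mapsto> R2 c2 x1 / x1\<close>:
  the cubic at \<open>x2 = t * x1\<close>, solved for its positive root \<open>x1\<close>.\<close>

definition x1_of_ratio :: "real \<Rightarrow> real \<Rightarrow> real" where
  "x1_of_ratio c2 t = 1 / (sqrt (2 * c2 * t) * (1 + t))"

lemma x1_of_ratio_pos: "c2 > 0 \<Longrightarrow> t > 0 \<Longrightarrow> x1_of_ratio c2 t > 0"
  by (simp add: x1_of_ratio_def)

lemma x1_of_ratio_sq:
  assumes "c2 > 0" "t > 0"
  shows "2 * c2 * t * (1 + t)^2 * (x1_of_ratio c2 t)^2 = 1"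
proof -
  have "1 + t \<noteq> 0" using assms by simp
  then show ?thesis
    using assms by (simp add: x1_of_ratio_def power_divide power_mult_distrib)
qed

lemma R2_eq_iff:
  assumes "c2 > 0" "x > 0" "y > 0"
  shows "R2 c2 x = y \<longleftrightarrow> x - 2 * c2 * y * (y + x)^2 = 0"
proof
  assume "R2 c2 x = y"
  then show "x - 2 * c2 * y * (y + x)^2 = 0"
    using theI'[OF R2_ex1[OF assms(1,2)]] by (simp add: R2_def)
next
  assume "x - 2 * c2 * y * (y + x)^2 = 0"
  then show "R2 c2 x = y"
    unfolding R2_def using the1_equality[OF R2_ex1[OF assms(1,2)]] assms(3) by blast
qed

text \<open>Putting \<open>x2 = t * x\<close> into the cubic leaves the factor
  \<open>1 - 2 * c2 * t * (1 + t)^2 * x^2\<close>, which has a single positive root in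
  \<open>x\<close>.\<close>

lemma R2_eq_ratio_iff:
  assumes "c2 > 0" "x > 0" "t > 0"
  shows "R2 c2 x = t * x \<longleftrightarrow> x = x1_of_ratio c2 t"
proof -
  have "x - 2 * c2 * (t * x) * (t * x + x)^2 = x * (1 - 2 * c2 * t * (1 + t)^2 * x^2)"
    by (simp add: power2_eq_square algebra_simps)
  then have "R2 c2 x = t * x \<longleftrightarrow> 2 * c2 * t * (1 + t)^2 * x^2 = 1"
    using R2_eq_iff[OF assms(1,2), of "t * x"] assms by auto
  also have "\<dots> \<longleftrightarrow> 2 * c2 * t * (1 + t)^2 * x^2
      = 2 * c2 * t * (1 + t)^2 * (x1_of_ratio c2 t)^2"
    using x1_of_ratio_sq[OF assms(1,3)] by simp
  also have "\<dots> \<longleftrightarrow> x^2 = (x1_of_ratio c2 t)^2"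
    using assms by simp
  also have "\<dots> \<longleftrightarrow> x = x1_of_ratio c2 t"
    using assms x1_of_ratio_pos[OF assms(1,3)] by (simp add: power2_eq_iff_nonneg)
  finally show ?thesis .
qed

lemma G1_ratio: "x > 0 \<Longrightarrow> G1 c1 x (t * x) = t / (1 + t)^2 - 2 * c1 * x^2"
proof -
  assume x: "x > 0"
  have "x + t * x = (1 + t) * x" by (simp add: algebra_simps)
  then have "x * (t * x) / (x + t * x)^2 = (x^2 * t) / (x^2 * (1 + t)^2)"
    by (simp add: power_mult_distrib power2_eq_square mult_ac)
  also have "\<dots> = t / (1 + t)^2" using x by simp
  finally show ?thesis by (simp add: G1_def)
qed

section \<open>The unique positive equilibrium\<close>

text \<open>A fixed point satisfies \<open>R2 c2 x = y\<close> and \<open>G1 c1 x y = 0\<close>. The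
  first condition puts it on the parametrised curve, the second then selects the ratio
  \<open>r\<close>.\<close>

lemma GR_pos_equilibrium_iff:
  assumes "c1 > 0" "c2 > 0" "\<delta> > 0"
  defines "r \<equiv> sqrt (c1 / c2)"
  shows "GR_pos_equilibrium c1 c2 \<delta> p \<longleftrightarrow>
    p = (x1_of_ratio c2 r, r * x1_of_ratio c2 r)"
proof -
  obtain x y where p: "p = (x, y)" by (cases p)
  have r: "r > 0" "r^2 = c1 / c2" using assms by (auto simp: r_def)
  have G1_zero: "G1 c1 (x1_of_ratio c2 t) (t * x1_of_ratio c2 t) = 0 \<longleftrightarrow> t = r"
    if "t > 0" for t
  proof -
    let ?x = "x1_of_ratio c2 t"
    have "G1 c1 ?x (t * ?x) = 0 \<longleftrightarrow> t / (1 + t)^2 = 2 * c1 * ?x^2"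
      using G1_ratio[OF x1_of_ratio_pos[OF assms(2) that]] by simp
    also have "?x^2 = 1 / (2 * c2 * t * (1 + t)^2)"
      using x1_of_ratio_sq[OF assms(2) that] assms that by (simp add: field_simps)
    \<comment> \<open>The factor \<open>(1 + t)^2\<close> occurs on both sides and cancels.\<close>
    also have "t / (1 + t)^2 = 2 * c1 * (1 / (2 * c2 * t * (1 + t)^2)) \<longleftrightarrow> t^2 = c1 / c2"
      using assms that by (simp add: divide_simps power2_eq_square mult_ac)
    also have "\<dots> \<longleftrightarrow> t = r"
      using r that by (metis power2_eq_iff_nonneg less_imp_le)
    finally show ?thesis .
  qed
  show ?thesis
  proof
    assume "GR_pos_equilibrium c1 c2 \<delta> p"
    then have xy: "x > 0" "y > 0" "G1 c1 x y = 0" "R2 c2 x = y"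
      using assms(3) by (auto simp: p GR_pos_equilibrium_def GR_step_def Let_def)
    define t where "t = y / x"
    have t: "t > 0" "y = t * x" using xy by (auto simp: t_def)
    then have "x = x1_of_ratio c2 t"
      using R2_eq_ratio_iff[OF assms(2) xy(1) t(1)] xy by simp
    then show "p = (x1_of_ratio c2 r, r * x1_of_ratio c2 r)"
      using G1_zero[OF t(1)] xy t p by auto
  next
    assume eq: "p = (x1_of_ratio c2 r, r * x1_of_ratio c2 r)"
    have "R2 c2 (x1_of_ratio c2 r) = r * x1_of_ratio c2 r"
      using R2_eq_ratio_iff x1_of_ratio_pos assms(2) r(1) by blast
    then show "GR_pos_equilibrium c1 c2 \<delta> p"
      using G1_zero[OF r(1)] r x1_of_ratio_pos[OF assms(2) r(1)]
      by (simp add: eq GR_pos_equilibrium_def GR_step_def Let_def)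
  qed
qed

section \<open>The derivative of the map at the equilibrium\<close>

text \<open>The logarithmic derivative is \<open>- 1 / (2 * t) - 1 / (1 + t)\<close>.\<close>

lemma x1_of_ratio_deriv:
  assumes "c2 > 0" "t > 0"
  shows "(x1_of_ratio c2 has_real_derivative
    - x1_of_ratio c2 t * (1 + 3 * t) / (2 * t * (1 + t))) (at t)"
proof -
  define s where "s = sqrt (2 * c2 * t)"
  have s: "s > 0" "s * s = 2 * c2 * t" using assms by (auto simp: s_def)
  have ne: "s * (1 + t) \<noteq> 0" using s assms by simp
  \<comment> \<open>Eliminating \<open>c2\<close> in favour of \<open>s\<close> removes the square
    root, so the comparison of derivatives is an identity of rational functions.\<close>
  have c2: "c2 = s * s / (2 * t)" using s assms by simp
  have "((\<lambda>t. 1 / (sqrt (2 * c2 * t) * (1 + t))) has_real_derivative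
      - ((inverse s / 2 * (2 * c2)) * (1 + t) + s) / (s * (1 + t))^2) (at t)"
    using assms(2) ne mult_pos_pos[OF assms] unfolding s_def
    by (auto intro!: derivative_eq_intros simp: power2_eq_square)
  moreover have "- ((inverse s / 2 * (2 * c2)) * (1 + t) + s) / (s * (1 + t))^2
      = - (1 / (s * (1 + t))) * (1 + 3 * t) / (2 * t * (1 + t))"
    unfolding c2 using s(1) assms(2) by (simp add: divide_simps power2_eq_square) algebra
  ultimately show ?thesis
    unfolding x1_of_ratio_def s_def by simp
qed

lemma R2_ratio_deriv:
  assumes "c2 > 0" "t > 0"
  defines "x \<equiv> x1_of_ratio c2 t"
  shows "((\<lambda>x. R2 c2 x / x) has_real_derivative - 2 * t * (1 + t) / (x * (1 + 3 * t))) (at x)"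
proof -
  have x: "x > 0" using x1_of_ratio_pos assms by (simp add: x_def)
  define d where "d = - x * (1 + 3 * t) / (2 * t * (1 + t))"
  have "d \<noteq> 0" using x assms by (simp add: d_def add_pos_pos)
  have "((\<lambda>x. R2 c2 x / x) has_derivative (*) (inverse d)) (at (x1_of_ratio c2 t))"
  \<comment> \<open>The inverse function theorem in this form yields the differentiability of
    \<open>R2\<close> too: it asks only for a left inverse of a continuous function on an open
    set.\<close>
  proof (rule has_derivative_inverse_strong[where S = "{0<..}" and f = "x1_of_ratio c2"
        and f' = "(*) d"])
    show "(x1_of_ratio c2 has_derivative (*) d) (at t)"
      using x1_of_ratio_deriv[OF assms(1,2)]
      by (simp add: d_def x_def has_field_derivative_def)
    show "(*) d \<circ> (*) (inverse d) = id" using \<open>d \<noteq> 0\<close> by auto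
    show "open {0::real<..}" "t \<in> {0<..}" using assms by auto
    show "continuous_on {0<..} (x1_of_ratio c2)"
      using x1_of_ratio_deriv[OF assms(1)]
      by (intro continuous_at_imp_continuous_on) (auto intro: DERIV_isCont)
    show "R2 c2 (x1_of_ratio c2 u) / x1_of_ratio c2 u = u" if "u \<in> {0<..}" for u
      using R2_eq_ratio_iff[OF assms(1) x1_of_ratio_pos[OF assms(1)], of u u]
        x1_of_ratio_pos[OF assms(1), of u] that by (simp add: field_simps)
  qed
  then show ?thesis by (simp add: d_def x_def has_field_derivative_def)
qed

lemma GR_map_deriv_equilibrium:
  assumes "c1 > 0" "c2 > 0" "\<delta> > 0"
  defines "r \<equiv> sqrt (c1 / c2)"
  defines "x \<equiv> x1_of_ratio c2 r"
  shows "(GR_map c1 c2 \<delta> has_real_derivative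
    1 - 4 * \<delta> * r * sqrt (2 * c2 * r) / (1 + 3 * r)) (at x)"
proof -
  have r: "r > 0" "r^2 = c1 / c2" using assms by (auto simp: r_def)
  have c1: "c1 = c2 * r^2" using r assms by simp
  have x: "x > 0" using x1_of_ratio_pos[OF assms(2) r(1)] by (simp add: x_def)
  define s where "s = sqrt (2 * c2 * r)"
  have s: "s > 0" "s * s = 2 * c2 * r" using assms r by (auto simp: s_def)
  have c2: "c2 = s * s / (2 * r)" using s r by simp
  define h' where "h' = - 2 * r * (1 + r) / (x * (1 + 3 * r))"
  have hx: "R2 c2 x / x = r"
    using R2_eq_ratio_iff[OF assms(2) x r(1)] x by (simp add: x_def)
  have h: "((\<lambda>x. R2 c2 x / x) has_real_derivative h') (at x)"
    using R2_ratio_deriv[OF assms(2) r(1)] by (simp add: x_def h'_def)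
  have outer: "((\<lambda>t. t / (1 + t)^2) has_real_derivative (1 - r) / (1 + r)^3) (at (R2 c2 x / x))"
  proof -
    have "1 + r \<noteq> 0" using r by simp
    then show ?thesis unfolding hx
      by (auto intro!: derivative_eq_intros simp: divide_simps power2_eq_square power3_eq_cube)
         algebra
  qed
  have comp: "((\<lambda>x. R2 c2 x / x / (1 + R2 c2 x / x)^2) has_real_derivative
      (1 - r) / (1 + r)^3 * h') (at x)"
    using DERIV_chain2[OF outer h] .
  have "((\<lambda>x. x + \<delta> * (R2 c2 x / x / (1 + R2 c2 x / x)^2 - 2 * c1 * x^2)) has_real_derivative
      1 + \<delta> * ((1 - r) / (1 + r)^3 * h' - 4 * c1 * x)) (at x)"
    by (rule derivative_eq_intros comp refl | simp)+
  moreover have "1 + \<delta> * ((1 - r) / (1 + r)^3 * h' - 4 * c1 * x)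
      = 1 - 4 * \<delta> * r * s / (1 + 3 * r)"
  proof -
    have xs: "x = 1 / (s * (1 + r))" by (simp add: x_def x1_of_ratio_def s_def)
    have "(1 - r) / (1 + r)^3 * h' = - 2 * r * s * (1 - r) / ((1 + r) * (1 + 3 * r))"
      unfolding h'_def xs using s(1) r(1)
      by (simp add: divide_simps power3_eq_cube)
    moreover have "4 * c1 * x = 2 * r * s / (1 + r)"
      unfolding c1 xs c2 using s(1) r(1) by (simp add: divide_simps power2_eq_square)
    \<comment> \<open>Over the common denominator,
      \<open>(1 - r) + (1 + 3 * r) = 2 * (1 + r)\<close> cancels \<open>1 + r\<close>.\<close>
    moreover have "- 2 * r * s * (1 - r) / ((1 + r) * (1 + 3 * r)) - 2 * r * s / (1 + r)
      = - 4 * r * s / (1 + 3 * r)"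
      using r(1) by (simp add: divide_simps) algebra
    ultimately show ?thesis by simp
  qed
  ultimately have "((\<lambda>x. x + \<delta> * (R2 c2 x / x / (1 + R2 c2 x / x)^2 - 2 * c1 * x^2))
      has_real_derivative 1 - 4 * \<delta> * r * s / (1 + 3 * r)) (at x)" by simp
  then show ?thesis unfolding s_def
  \<comment> \<open>The rewriting of \<open>G1\<close> in terms of the ratio is available for
    positive arguments, hence the transfer on the open half-line.\<close>
  proof (rule has_field_derivative_transform_within_open[of _ _ _ "{0<..}"])
    show "u + \<delta> * (R2 c2 u / u / (1 + R2 c2 u / u)^2 - 2 * c1 * u^2) = GR_map c1 c2 \<delta> u"
      if "u \<in> {0<..}" for u
      using that G1_ratio[of u c1 "R2 c2 u / u"] by (simp add: GR_map_def)
  qed (use x in auto)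
qed

section \<open>Stability and the sign of \<open>R_GR\<close>\<close>

text \<open>This is \<open>(1 - DQ) / 2\<close>, so that \<open>DQ = -1\<close> and
  \<open>DQ = 1\<close> correspond to the values 1 and 0.\<close>

definition half_drop :: "real \<Rightarrow> real \<Rightarrow> real \<Rightarrow> real" where
  "half_drop c1 c2 \<delta> =
    (let r = sqrt (c1 / c2) in 2 * \<delta> * r * sqrt (2 * c2 * r) / (1 + 3 * r))"

lemma GR_differentiable_DQ:
  assumes "c1 > 0" "c2 > 0" "\<delta> > 0"
  shows "GR_differentiable c1 c2 \<delta>" "DQ c1 c2 \<delta> = 1 - 2 * half_drop c1 c2 \<delta>"
proof -
  have "GR_equilibrium c1 c2 \<delta> = (let r = sqrt (c1 / c2) in
      (x1_of_ratio c2 r, r * x1_of_ratio c2 r))"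
    unfolding GR_equilibrium_def GR_pos_equilibrium_iff[OF assms] Let_def by simp
  then have "(GR_map c1 c2 \<delta> has_real_derivative 1 - 2 * half_drop c1 c2 \<delta>)
      (at (fst (GR_equilibrium c1 c2 \<delta>)))"
    using GR_map_deriv_equilibrium[OF assms] by (simp add: Let_def half_drop_def mult.assoc)
  then show "GR_differentiable c1 c2 \<delta>" "DQ c1 c2 \<delta> = 1 - 2 * half_drop c1 c2 \<delta>"
    by (auto simp: GR_differentiable_def DQ_def real_differentiable_def intro: DERIV_imp_deriv)
qed

text \<open>With \<open>c1 = c2 * r^2\<close>, \<open>R_GR\<close> is quadratic in
  \<open>\<delta>^2\<close> and splits into two factors. One is the numerator of
  \<open>half_drop^2 - 1\<close>; the other is positive and goes into \<open>m\<close>.\<close>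

lemma R_GR_factor:
  assumes "c1 > 0" "c2 > 0" "\<delta> > 0"
  obtains m where "m > 0" "R_GR c1 c2 \<delta> = m * ((half_drop c1 c2 \<delta>)^2 - 1)"
proof
  define r where "r = sqrt (c1 / c2)"
  have r: "r > 0" "r^2 = c1 / c2" using assms by (auto simp: r_def)
  have c1: "c1 = c2 * r^2" using r assms by simp
  define m where "m = c2^2 * ((1 - 3 * r)^2 + 8 * \<delta>^2 * c1 * r) * (1 + 3 * r)^2"
  \<comment> \<open>The square vanishes at \<open>r = 1 / 3\<close>, so strictness comes from the
    second summand.\<close>
  have "(1 - 3 * r)^2 + 8 * \<delta>^2 * c1 * r > 0"
    using assms r by (intro add_nonneg_pos) auto
  moreover have "1 + 3 * r \<noteq> 0" using r by simp
  ultimately show "m > 0" unfolding m_def using assms by (intro mult_pos_pos) auto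
  have "(half_drop c1 c2 \<delta>)^2 = 8 * \<delta>^2 * c2 * r^3 / (1 + 3 * r)^2"
  proof -
    have "(half_drop c1 c2 \<delta>)^2 = (2 * \<delta> * r)^2 * (sqrt (2 * c2 * r))^2 / (1 + 3 * r)^2"
      by (simp add: half_drop_def Let_def r_def[symmetric] power_divide power_mult_distrib)
    also have "(sqrt (2 * c2 * r))^2 = 2 * c2 * r" using assms r(1) by simp
    also have "(2 * \<delta> * r)^2 * (2 * c2 * r) = 8 * \<delta>^2 * c2 * r^3" by algebra
    finally show ?thesis .
  qed
  then have "(1 + 3 * r)^2 * ((half_drop c1 c2 \<delta>)^2 - 1) = 8 * \<delta>^2 * c2 * r^3 - (1 + 3 * r)^2"
    using \<open>1 + 3 * r \<noteq> 0\<close> by (simp add: right_diff_distrib)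
  then have "m * ((half_drop c1 c2 \<delta>)^2 - 1) = c2^2 * ((1 - 3 * r)^2 + 8 * \<delta>^2 * c1 * r)
      * (8 * \<delta>^2 * c2 * r^3 - (1 + 3 * r)^2)"
    unfolding m_def by (simp add: mult.assoc)
  also have "\<dots> = R_GR c1 c2 \<delta>" unfolding c1 R_GR_def by algebra
  finally show "R_GR c1 c2 \<delta> = m * ((half_drop c1 c2 \<delta>)^2 - 1)" by simp
qed

lemma half_drop_pos:
  assumes "c1 > 0" "c2 > 0" "\<delta> > 0"
  shows "half_drop c1 c2 \<delta> > 0"
proof -
  have "sqrt (c1 / c2) > 0" using assms by simp
  then show ?thesis
    unfolding half_drop_def Let_def using assms
    by (intro divide_pos_pos mult_pos_pos real_sqrt_gt_zero add_pos_pos) auto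
qed

text \<open>As \<open>half_drop\<close> is positive, \<open>DQ < 1\<close> always holds, and
  \<open>DQ > -1\<close> means \<open>half_drop < 1\<close>. The converse direction is what confines
  the stable set when its frontier is studied.\<close>

lemma GR_locally_stable_iff:
  assumes "c1 > 0" "c2 > 0" "\<delta> > 0"
  shows "GR_locally_stable c1 c2 \<delta> \<longleftrightarrow> R_GR c1 c2 \<delta> < 0"
proof -
  let ?k = "half_drop c1 c2 \<delta>"
  obtain m where m: "m > 0" "R_GR c1 c2 \<delta> = m * (?k^2 - 1)"
    using R_GR_factor[OF assms] .
  have k: "?k > 0" using half_drop_pos[OF assms] .
  have "GR_locally_stable c1 c2 \<delta> \<longleftrightarrow> \<bar>?k\<bar> < 1"
    using k by (auto simp: GR_locally_stable_def GR_differentiable_DQ[OF assms])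
  also have "\<dots> \<longleftrightarrow> R_GR c1 c2 \<delta> < 0"
    using m by (simp add: mult_less_0_iff abs_square_less_1)
  finally show ?thesis .
qed

section \<open>Loss of stability\<close>

lemma GR_loses_stability_imp_R_GR_eq_0:
  assumes "GR_loses_stability c1 c2 \<delta>"
  shows "R_GR c1 c2 \<delta> = 0"
proof -
  \<comment> \<open>A closed set containing the stable set, and so its frontier; strict negativity
    is ruled out since the point itself is not stable.\<close>
  let ?S = "{p. (case p of (c1, c2, \<delta>) \<Rightarrow> R_GR c1 c2 \<delta>) \<le> 0}"
  have pos: "c1 > 0" "c2 > 0" "\<delta> > 0" using assms by (auto simp: GR_loses_stability_def)
  have "closed ?S"
    unfolding R_GR_def case_prod_unfold
    by (intro closed_Collect_le continuous_intros)
  moreover have "GR_stable_set \<subseteq> ?S"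
    using GR_locally_stable_iff by (force simp: GR_stable_set_def)
  ultimately have "closure GR_stable_set \<subseteq> ?S" by (rule closure_minimal[rotated])
  then have "R_GR c1 c2 \<delta> \<le> 0"
    using assms by (auto simp: GR_loses_stability_def frontier_def)
  moreover have "\<not> R_GR c1 c2 \<delta> < 0"
    using assms GR_locally_stable_iff[OF pos]
    by (auto simp: GR_loses_stability_def GR_stable_set_def)
  ultimately show ?thesis by simp
qed

lemma DQ_eq_minus_1:
  assumes "c1 > 0" "c2 > 0" "\<delta> > 0" "R_GR c1 c2 \<delta> = 0"
  shows "DQ c1 c2 \<delta> = -1"
proof -
  obtain m where "m > 0" "R_GR c1 c2 \<delta> = m * ((half_drop c1 c2 \<delta>)^2 - 1)"
    using R_GR_factor[OF assms(1-3)] .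
  then have "(half_drop c1 c2 \<delta>)^2 = 1" using assms(4) by simp
  \<comment> \<open>Positivity discards the root -1.\<close>
  then have "half_drop c1 c2 \<delta> = 1"
    using half_drop_pos[OF assms(1-3)] by (auto simp: power2_eq_1_iff)
  then show ?thesis using GR_differentiable_DQ[OF assms(1-3)] by simp
qed

theorem theorem1:
  fixes c1 c2 \<delta> :: real
  assumes "c1 > 0" and "c2 > 0" and "\<delta> > 0"
  shows "(\<exists>!p. GR_pos_equilibrium c1 c2 \<delta> p)
    \<and> (R_GR c1 c2 \<delta> < 0 \<longrightarrow> GR_locally_stable c1 c2 \<delta>)
    \<and> (GR_loses_stability c1 c2 \<delta> \<longrightarrow>
          GR_period_doubling_possible c1 c2 \<delta> \<and> \<not> GR_fold_possible c1 c2 \<delta>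
          \<and> R_GR c1 c2 \<delta> = 0)"
proof (intro conjI impI)
  show "\<exists>!p. GR_pos_equilibrium c1 c2 \<delta> p"
    unfolding GR_pos_equilibrium_iff[OF assms] by simp
  show "GR_locally_stable c1 c2 \<delta>" if "R_GR c1 c2 \<delta> < 0"
    using that GR_locally_stable_iff[OF assms] by simp
  assume loses: "GR_loses_stability c1 c2 \<delta>"
  show R: "R_GR c1 c2 \<delta> = 0" using GR_loses_stability_imp_R_GR_eq_0[OF loses] .
  show "GR_period_doubling_possible c1 c2 \<delta>" "\<not> GR_fold_possible c1 c2 \<delta>"
    using loses GR_differentiable_DQ(1)[OF assms] DQ_eq_minus_1[OF assms R]
    by (auto simp: GR_period_doubling_possible_def GR_fold_possible_def)
qed

end
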